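(* Consider a sequential decision process with finite tree of decision points $\mathcal{J}$ and decision sets $X_j$ ($j\in\mathcal{J}$), let $T\ge 1$, let $x^1,\dots,x^T\in X=\prod_{j\in\mathcal{J}}X_j$ be any strategies, and for each $t=1,\dots,T$ and $j\in\mathcal{J}$ let $\ell^t_j:X_j\to\mathbb{R}$ be a convex function. Let $R^T$ be the cumulative regret on $X$ with respect to the losses $\ell^t(x)=\sum_{j\in\mathcal{J}}\pi_j(x)\,\ell^t_j(x_j)$, and let $\hat R^T_j$ be the laminar regret at decision point $j$. Then $$R^T\le\max_{\hat x\in X}\sum_{j\in\mathcal{J}}\pi_j(\hat x)\,\hat R^T_j.$$
   Context: **Sequential decision process.** $\mathcal{J}$ is a finite set of decision points. Each $j\in\mathcal{J}$ has a finite action set $A_j$ with $|A_j|=n_j$ and a (nonempty) compact convex decision set $X_j\subseteq\Delta_{n_j}$, where $\Delta_{n_j}$ is the probability simplex over $A_j$; for $x_j\in X_j$, $x_{j,a}$ is the coordinate of action $a$. For $j\in\mathcal{J}$ and $a\in A_j$, $\mathcal{C}_{j,a}\subseteq\mathcal{J}$ is the (possibly empty) set of possible next decision points after taking action $a$ at $j$. The decision points form a tree with root $r$: the sets $\mathcal{C}_{j,a}$ are pairwise disjoint, and every $j'\neq r$ is reached from $r$ by a unique path. **Strategies and reach.** $X=\prod_{j\in\mathcal{J}}X_j$. For $x\in X$, $x_j$ is its component in $X_j$, and $x_{\triangle_j}$ is the part of $x$ consisting of the components at $j$ and at all descendants of $j$. The reach $\pi_j(x)$ is the product of the entries $x_{i,a}$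 over all decision point–action pairs $(i,a)$ on the path from the root $r$ to $j$; that is, $\pi_r(x)=1$ and $\pi_{j'}(x)=\pi_j(x)\,x_{j,a}$ for $j'\in\mathcal{C}_{j,a}$. **Cumulative regret on $X$.** With $\ell^t(x)=\sum_{j\in\mathcal{J}}\pi_j(x)\,\ell^t_j(x_j)$, $$R^T=\sum_{t=1}^T\ell^t(x^t)-\min_{\hat x\in X}\sum_{t=1}^T\ell^t(\hat x).$$ **Values, local losses, laminar regret.** For each $t$ and $j$, recursively (from the leaves up) $$\hat V^t_{\triangle_j}(\hat x_{\triangle_j})=\ell^t_j(\hat x_j)+\sum_{a\in A_j}\sum_{j'\in\mathcal{C}_{j,a}}\hat x_{j,a}\,\hat V^t_{\triangle_{j'}}(\hat x_{\triangle_{j'}}),\qquad V^t_{\triangle_j}=\hat V^t_{\triangle_j}(x^t_{\triangle_j}),$$ $$\hat\ell^t_j(x_j)=\ell^t_j(x_j)+\sum_{a\in A_j}\sum_{j'\in\mathcal{C}_{j,a}}x_{j,a}\,V^t_{\triangle_{j'}}\qquad(x_j\in X_j),$$ $$\hat R^T_j=\sum_{t=1}^T\hat\ell^t_j(x^t_j)-\min_{\hat x_j\in X_j}\sum_{t=1}^T\hat\ell^t_j(\hat x_j).$$ Minima are read as infima if they are not attained. *)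

theory Defs
  imports "HOL-Analysis.Analysis"
begin

text \<open>
  All action sets live in one finite type \<open>'a\<close>; the probability simplex over \<open>S\<close> is embedded in
  \<open>real ^ 'a\<close> by setting the coordinates outside \<open>S\<close> to zero.
\<close>

definition simplex_over :: "'a::finite set \<Rightarrow> (real ^ 'a) set" where
  "simplex_over S = {y. (\<forall>a. 0 \<le> y $ a) \<and> (\<forall>a. a \<notin> S \<longrightarrow> y $ a = 0) \<and> (\<Sum>a\<in>S. y $ a) = 1}"

text \<open>
  A path is recorded as the list of decision point--action pairs taken along it; the end point is
  not an entry of the list.
\<close>

inductive tree_path ::
    "('j \<Rightarrow> 'a set) \<Rightarrow> ('j \<Rightarrow> 'a \<Rightarrow> 'j set) \<Rightarrow> 'j \<Rightarrow> ('j \<times> 'a) list \<Rightarrow> 'j \<Rightarrow> bool"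
  for A C i where
  Nil: "tree_path A C i [] i"
| snoc: "tree_path A C i p j \<Longrightarrow> a \<in> A j \<Longrightarrow> k \<in> C j a \<Longrightarrow> tree_path A C i (p @ [(j, a)]) k"

text \<open>
  In \<open>unique_path\<close> the case \<open>j = r\<close> says that the empty path is the only path from the root to
  itself, i.e. that the root is not a successor of any decision point.
\<close>

locale decision_process =
  fixes J :: "'j set"
    and A :: "'j \<Rightarrow> 'a::finite set"
    and C :: "'j \<Rightarrow> 'a \<Rightarrow> 'j set"
    and r :: 'j
    and X :: "'j \<Rightarrow> (real ^ 'a) set"
  assumes finite_J: "finite J"
    and root_in: "r \<in> J"
    and succ_subset: "\<And>j a. j \<in> J \<Longrightarrow> a \<in> A j \<Longrightarrow> C j a \<subseteq> J"
    and succ_disjoint: "disjoint_family_on (\<lambda>(j, a). C j a) (SIGMA j:J. A j)"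
    and unique_path: "\<And>j. j \<in> J \<Longrightarrow> \<exists>!p. tree_path A C r p j"
    and X_nonempty: "\<And>j. j \<in> J \<Longrightarrow> X j \<noteq> {}"
    and X_compact: "\<And>j. j \<in> J \<Longrightarrow> compact (X j)"
    and X_convex: "\<And>j. j \<in> J \<Longrightarrow> convex (X j)"
    and X_simplex: "\<And>j. j \<in> J \<Longrightarrow> X j \<subseteq> simplex_over (A j)"
begin

definition strategies :: "('j \<Rightarrow> real ^ 'a) set" where
  "strategies = Pi\<^sub>E J X"

definition path_to :: "'j \<Rightarrow> ('j \<times> 'a) list" where
  "path_to j = (THE p. tree_path A C r p j)"

definition reach :: "'j \<Rightarrow> ('j \<Rightarrow> real ^ 'a) \<Rightarrow> real" where
  "reach j x = (\<Prod>(i, a)\<leftarrow>path_to j. x i $ a)"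

lemma path_to_eq: "j \<in> J \<Longrightarrow> tree_path A C r p j \<Longrightarrow> path_to j = p"
  unfolding path_to_def using unique_path by (metis the1_equality)

lemma tree_path_to: "j \<in> J \<Longrightarrow> tree_path A C r (path_to j) j"
  unfolding path_to_def using unique_path by (metis theI)

lemma path_to_root: "path_to r = []"
  by (intro path_to_eq root_in tree_path.Nil)

lemma path_to_succ:
  assumes "j \<in> J" "a \<in> A j" "k \<in> C j a"
  shows "path_to k = path_to j @ [(j, a)]"
  by (intro path_to_eq tree_path.snoc tree_path_to) (use assms succ_subset in auto)

lemma reach_root: "reach r x = 1"
  by (simp add: reach_def path_to_root)

lemma reach_succ:
  "j \<in> J \<Longrightarrow> a \<in> A j \<Longrightarrow> k \<in> C j a \<Longrightarrow> reach k x = reach j x * x j $ a"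
  by (simp add: reach_def path_to_succ)

text \<open>
  The value of the subtree at \<open>j\<close> under the losses \<open>f\<close>. It takes a whole strategy \<open>x\<close> but reads
  only the components at \<open>j\<close> and its descendants. The value \<open>0\<close> outside \<open>J\<close> is a dummy that is
  never reached from within \<open>J\<close>.
\<close>

function subtree_value ::
    "('j \<Rightarrow> real ^ 'a \<Rightarrow> real) \<Rightarrow> 'j \<Rightarrow> ('j \<Rightarrow> real ^ 'a) \<Rightarrow> real" where
  "subtree_value f j x =
    (if j \<in> J then f j (x j) + (\<Sum>a\<in>A j. \<Sum>k\<in>C j a. x j $ a * subtree_value f k x) else 0)"
  by pat_completeness auto
termination
proof (relation "Wellfounded.measure (\<lambda>(f, j, x). Max ((\<lambda>j. length (path_to j)) ` J) - length (path_to j))",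
    goal_cases)
  case 1
  show ?case by simp
next
  case (2 f j x a k)
  then have k: "k \<in> J" using succ_subset by blast
  have "length (path_to k) \<le> Max ((\<lambda>j. length (path_to j)) ` J)"
    using k finite_J by simp
  moreover have "length (path_to k) = Suc (length (path_to j))"
    using 2 by (simp add: path_to_succ)
  ultimately show ?case by simp
qed

declare subtree_value.simps [simp del]

lemma tree_path_Cons:
  assumes "a \<in> A j" "k \<in> C j a" "tree_path A C k p i"
  shows "tree_path A C j ((j, a) # p) i"
  using assms(3)
proof induction
  case Nil
  show ?case using tree_path.snoc [of A C j "[]" j a k] assms(1,2) by (simp add: tree_path.Nil)
next
  case (snoc p i b m)
  show ?case using tree_path.snoc [of A C j "(j, a) # p" i b m] snoc by simp
qed

lemma subtree_value_cong:
  "(\<And>p k. tree_path A C j p k \<Longrightarrow> x k = y k) \<Longrightarrow> subtree_value f j x = subtree_value f j y"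
proof (induction f j x rule: subtree_value.induct)
  case (1 f j x)
  have "x j = y j" using 1(2) tree_path.Nil .
  moreover have "subtree_value f k x = subtree_value f k y"
    if "j \<in> J" "a \<in> A j" "k \<in> C j a" for a k
    using that by (intro 1(1)) (auto intro: 1(2) tree_path_Cons)
  ultimately show ?case
    by (simp add: subtree_value.simps [of f j])
qed

definition total_loss :: "('j \<Rightarrow> real ^ 'a \<Rightarrow> real) \<Rightarrow> ('j \<Rightarrow> real ^ 'a) \<Rightarrow> real" where
  "total_loss f x = (\<Sum>j\<in>J. reach j x * f j (x j))"

text \<open>
  Minima are read as infima, as convex losses on a compact set need not attain them. These
  infima are over nonempty sets of reals that are bounded below, because a convex function on a
  compact convex subset of \<open>real ^ 'a\<close> is bounded below.
\<close>

definition regret ::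
    "(nat \<Rightarrow> 'j \<Rightarrow> real ^ 'a \<Rightarrow> real) \<Rightarrow> (nat \<Rightarrow> 'j \<Rightarrow> real ^ 'a) \<Rightarrow> nat \<Rightarrow> real" where
  "regret l x T =
    (\<Sum>t=1..T. total_loss (l t) (x t)) - (INF y\<in>strategies. \<Sum>t=1..T. total_loss (l t) y)"

definition local_loss ::
    "('j \<Rightarrow> real ^ 'a \<Rightarrow> real) \<Rightarrow> ('j \<Rightarrow> real ^ 'a) \<Rightarrow> 'j \<Rightarrow> real ^ 'a \<Rightarrow> real" where
  "local_loss f x j y = f j y + (\<Sum>a\<in>A j. \<Sum>k\<in>C j a. y $ a * subtree_value f k x)"

definition laminar_regret ::
    "(nat \<Rightarrow> 'j \<Rightarrow> real ^ 'a \<Rightarrow> real) \<Rightarrow> (nat \<Rightarrow> 'j \<Rightarrow> real ^ 'a) \<Rightarrow> nat \<Rightarrow> 'j \<Rightarrow> real" where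
  "laminar_regret l x T j =
    (\<Sum>t=1..T. local_loss (l t) (x t) j (x t j))
      - (INF y\<in>X j. \<Sum>t=1..T. local_loss (l t) (x t) j y)"

definition weighted_regret ::
    "(nat \<Rightarrow> 'j \<Rightarrow> real ^ 'a \<Rightarrow> real) \<Rightarrow> (nat \<Rightarrow> 'j \<Rightarrow> real ^ 'a) \<Rightarrow> nat \<Rightarrow> ('j \<Rightarrow> real ^ 'a) \<Rightarrow> real" where
  "weighted_regret l x T y = (\<Sum>j\<in>J. reach j y * laminar_regret l x T j)"

end

end

theory Submission
  imports Defs
begin

text \<open>
  In the sum over \<open>j\<close> of \<open>reach j y * (V j - local_loss j (y j))\<close>, where \<open>V j\<close> is the value of
  the subtree at \<open>j\<close> under \<open>x\<close>, the values of all successors telescope, so that only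
  \<open>V r - total_loss y\<close> remains; for \<open>y = x\<close> every term vanishes, so \<open>V r = total_loss x\<close>. As
  \<open>V j = local_loss j (x j)\<close>, the regret against a fixed comparator \<open>y\<close> is the sum of the
  local regrets against its components \<open>y j\<close>, weighted by the reach under \<open>y\<close>.
\<close>

section \<open>Lower bounds for convex functions\<close>

text \<open>
  Near a relative interior point \<open>c\<close>, \<open>f\<close> is bounded above; reflecting \<open>y\<close> through \<open>c\<close>, scaled
  down to stay near \<open>c\<close>, turns this into a lower bound at \<open>y\<close>.
\<close>

lemma convex_on_bounded_below:
  fixes f :: "'a::euclidean_space \<Rightarrow> real"
  assumes f: "convex_on S f" and S: "bounded S"
  shows "bdd_below (f ` S)"
proof (cases "S = {}")
  case False
  \<comment> \<open>The hull of an affine basis inside \<open>S\<close> is a simplex on which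
    \<open>f\<close> is at most its maximum over finitely many vertices. Having the same affine hull
    as \<open>S\<close>, it contains a relative ball in which the reflections of all points of
    \<open>S\<close> can be placed.\<close>
  obtain B where B: "\<not> affine_dependent B" "B \<subseteq> S" "affine hull B = affine hull S"
    using affine_basis_exists by metis
  have "finite B" using B(1) aff_independent_finite by blast
  have "convex S" using f by (simp add: convex_on_def)
  have hull: "convex hull B \<subseteq> S" using B(2) \<open>convex S\<close> by (simp add: hull_minimal)
  have "convex_on (convex hull B) f" using f hull convex_on_subset by auto
  then have M: "f z \<le> Max (f ` B)" if "z \<in> convex hull B" for z
    using convex_on_convex_hull_bound [of B f "Max (f ` B)"] that \<open>finite B\<close> by auto
  have "convex hull B \<noteq> {}" using B(3) False by auto
  then obtain c where "c \<in> rel_interior (convex hull B)"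
    using rel_interior_eq_empty convex_convex_hull by blast
  then obtain e where c: "c \<in> convex hull B" and "e > 0"
    and e: "cball c e \<inter> affine hull S \<subseteq> convex hull B"
    by (auto simp: mem_rel_interior_cball B(3))
  obtain b where "b > 0" and b: "\<And>y. y \<in> S \<Longrightarrow> norm (c - y) \<le> b"
  proof -
    obtain u where "u > 0" "\<And>y. y \<in> S \<Longrightarrow> norm y \<le> u" using S by (auto simp: bounded_pos)
    then show ?thesis
      using that [of "norm c + u"] norm_triangle_le_diff by (metis add_left_mono add_nonneg_pos norm_ge_zero)
  qed
  \<comment> \<open>This scale puts each reflected point within \<open>d * b = e\<close> of
    \<open>c\<close>.\<close>
  define d where "d = e / b"
  have "d > 0" using \<open>e > 0\<close> \<open>b > 0\<close> by (simp add: d_def)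
  have "(f c * (1 + d) - Max (f ` B)) / d \<le> f y" if y: "y \<in> S" for y
  proof -
    define z where "z = c + d *\<^sub>R (c - y)"
    have "d * norm (c - y) \<le> d * b" using b [OF y] \<open>d > 0\<close> by simp
    also have "d * b = e" using \<open>b > 0\<close> by (simp add: d_def)
    finally have "z \<in> cball c e" using \<open>d > 0\<close> by (simp add: z_def dist_norm)
    moreover have "z \<in> affine hull S"
    proof -
      have "c \<in> affine hull S" "y \<in> affine hull S" using c hull y hull_inc by (metis subsetD)+
      then have "(1 + d) *\<^sub>R c + (- d) *\<^sub>R y \<in> affine hull S"
        using affine_affine_hull [of S] by (intro mem_affine) auto
      then show ?thesis by (simp add: z_def algebra_simps)
    qed
    ultimately have z: "z \<in> convex hull B" using e by blast
    have "c = (1 / (1 + d)) *\<^sub>R z + (d / (1 + d)) *\<^sub>R y"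
    proof -
      have "(1 + d) *\<^sub>R c = z + d *\<^sub>R y" by (simp add: z_def algebra_simps)
      then have "(1 / (1 + d)) *\<^sub>R (1 + d) *\<^sub>R c = (1 / (1 + d)) *\<^sub>R (z + d *\<^sub>R y)" by simp
      then show ?thesis using \<open>d > 0\<close> by (simp add: scaleR_add_right)
    qed
    moreover have "1 / (1 + d) + d / (1 + d) = 1"
      using \<open>d > 0\<close> by (simp add: add_divide_distrib [symmetric])
    moreover have "z \<in> S" "0 \<le> 1 / (1 + d)" "0 \<le> d / (1 + d)"
      using z hull \<open>d > 0\<close> by auto
    ultimately have "f c \<le> 1 / (1 + d) * f z + d / (1 + d) * f y"
      using f y unfolding convex_on_def by metis
    also have "\<dots> = (f z + d * f y) / (1 + d)" by (simp add: add_divide_distrib)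
    finally have "f c * (1 + d) \<le> f z + d * f y" using \<open>d > 0\<close> by (simp add: pos_le_divide_eq)
    then show ?thesis using M [OF z] \<open>d > 0\<close> by (simp add: pos_divide_le_eq mult.commute)
  qed
  then show ?thesis by (auto intro!: bdd_belowI)
qed simp

lemma bdd_below_add:
  fixes f g :: "'a \<Rightarrow> real"
  assumes "bdd_below (f ` S)" "bdd_below (g ` S)"
  shows "bdd_below ((\<lambda>y. f y + g y) ` S)"
proof -
  obtain u v where "\<forall>y\<in>S. u \<le> f y" "\<forall>y\<in>S. v \<le> g y"
    using assms unfolding bdd_below_def by auto
  then show ?thesis by (intro bdd_belowI2 [where m = "u + v"]) (simp add: add_mono)
qed

lemma bdd_below_sum:
  fixes f :: "'i \<Rightarrow> 'a \<Rightarrow> real"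
  assumes "\<And>i. i \<in> I \<Longrightarrow> bdd_below (f i ` S)"
  shows "bdd_below ((\<lambda>y. \<Sum>i\<in>I. f i y) ` S)"
  using assms
proof (induction I rule: infinite_finite_induct)
  case (insert i I)
  then show ?case using bdd_below_add [of "f i" S] by simp
qed auto

context decision_process
begin

section \<open>Tree structure and telescoping of values\<close>

lemma finite_succ: "j \<in> J \<Longrightarrow> a \<in> A j \<Longrightarrow> finite (C j a)"
  using finite_J finite_subset succ_subset by blast

lemma tree_path_end_in: "tree_path A C r p j \<Longrightarrow> j \<in> J"
  by (induction rule: tree_path.induct) (use root_in succ_subset in auto)

text \<open>The path to a successor is nonempty, so it is not the root; conversely, the last step of
  the path to any other point names its predecessor.\<close>

lemma Union_succ: "(\<Union>(j, a)\<in>(SIGMA j:J. A j). C j a) = J - {r}"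
proof (intro equalityI subsetI)
  fix k assume "k \<in> (\<Union>(j, a)\<in>(SIGMA j:J. A j). C j a)"
  then obtain j a where "j \<in> J" "a \<in> A j" "k \<in> C j a" by auto
  then show "k \<in> J - {r}" using path_to_succ [of j a k] path_to_root succ_subset by auto
next
  fix k assume "k \<in> J - {r}"
  then have "tree_path A C r (path_to k) k" "k \<noteq> r" using tree_path_to by auto
  then show "k \<in> (\<Union>(j, a)\<in>(SIGMA j:J. A j). C j a)"
    by (cases rule: tree_path.cases) (auto dest: tree_path_end_in)
qed

text \<open>By \<open>succ_disjoint\<close> and \<open>Union_succ\<close>, every decision point
  except the root is counted exactly once.\<close>

lemma sum_succ:
  fixes g :: "'j \<Rightarrow> real"
  shows "(\<Sum>j\<in>J. \<Sum>a\<in>A j. \<Sum>k\<in>C j a. g k) = sum g J - g r"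
proof -
  have "(\<Sum>j\<in>J. \<Sum>a\<in>A j. \<Sum>k\<in>C j a. g k) = (\<Sum>(j, a)\<in>(SIGMA j:J. A j). \<Sum>k\<in>C j a. g k)"
    using finite_J by (simp add: sum.Sigma)
  also have "\<dots> = sum g (\<Union>(j, a)\<in>(SIGMA j:J. A j). C j a)"
    using finite_J finite_succ succ_disjoint
    by (subst sum.UNION_disjoint) (auto simp: disjoint_family_on_def intro!: sum.cong)
  finally show ?thesis using finite_J root_in by (simp add: Union_succ sum_diff1)
qed

lemma local_loss_self: "j \<in> J \<Longrightarrow> local_loss f x j (x j) = subtree_value f j x"
  by (simp add: local_loss_def subtree_value.simps [of f j])

lemma telescoping:
  "(\<Sum>j\<in>J. reach j y * (subtree_value f j x - local_loss f x j (y j)))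
    = subtree_value f r x - total_loss f y"
proof -
  \<comment> \<open>The factor \<open>y j $ a\<close> turns the reach of \<open>j\<close> into the
    reach of its successor \<open>k\<close>.\<close>
  have "(\<Sum>j\<in>J. reach j y * (\<Sum>a\<in>A j. \<Sum>k\<in>C j a. y j $ a * subtree_value f k x))
    = (\<Sum>j\<in>J. \<Sum>a\<in>A j. \<Sum>k\<in>C j a. reach k y * subtree_value f k x)"
    by (intro sum.cong refl) (auto simp: sum_distrib_left reach_succ mult.assoc intro!: sum.cong)
  also have "\<dots> = (\<Sum>j\<in>J. reach j y * subtree_value f j x) - subtree_value f r x"
    by (simp add: sum_succ reach_root)
  finally show ?thesis
    by (simp add: local_loss_def total_loss_def algebra_simps sum.distrib sum_subtractf)
qed

lemma total_loss_eq_value: "total_loss f x = subtree_value f r x"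
  using telescoping [of x f x] by (simp add: local_loss_self)

lemma total_loss_diff:
  "total_loss f x - total_loss f y
    = (\<Sum>j\<in>J. reach j y * (local_loss f x j (x j) - local_loss f x j (y j)))"
  by (simp add: total_loss_eq_value [of f x] telescoping [symmetric] local_loss_self)

section \<open>Signs of the weights and boundedness of the local losses\<close>

lemma reach_nonneg:
  assumes "y \<in> strategies" "j \<in> J"
  shows "0 \<le> reach j y"
  using tree_path_to [OF \<open>j \<in> J\<close>] \<open>j \<in> J\<close>
proof (induction "path_to j" j rule: tree_path.induct)
  case Nil
  show ?case by (simp add: reach_root)
next
  case (snoc p j a k)
  have j: "j \<in> J" using snoc tree_path_end_in by blast
  then have "y j \<in> simplex_over (A j)"
    using assms(1) X_simplex by (auto simp: strategies_def)
  then show ?case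
    \<comment> \<open>The prefix \<open>p\<close> is itself the unique path to \<open>j\<close>, so
      the induction hypothesis applies.\<close>
    using j snoc path_to_eq [of j p] by (simp add: reach_succ simplex_over_def)
qed

text \<open>Convexity bounds \<open>f j\<close> from below, and simplex coordinates in [0, 1] bound
  the linear terms. This makes the infimum in \<open>laminar_regret\<close> a true lower
  bound.\<close>

lemma bdd_below_local_loss:
  assumes "j \<in> J" "convex_on (X j) (f j)"
  shows "bdd_below (local_loss f x j ` X j)"
proof -
  have coord: "0 \<le> y $ a \<and> y $ a \<le> 1" if "y \<in> X j" "a \<in> A j" for y a
  proof -
    have y: "y \<in> simplex_over (A j)" using that X_simplex [OF \<open>j \<in> J\<close>] by auto
    then have "y $ a \<le> (\<Sum>a\<in>A j. y $ a)"
      using that by (intro member_le_sum) (auto simp: simplex_over_def)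
    with y show ?thesis by (simp add: simplex_over_def)
  qed
  have "bdd_below ((\<lambda>y. y $ a * v) ` X j)" if "a \<in> A j" for a v
  proof (rule bdd_belowI2)
    fix y assume "y \<in> X j"
    then have "\<bar>y $ a\<bar> \<le> 1" using coord that by fastforce
    then have "\<bar>y $ a * v\<bar> \<le> \<bar>v\<bar>" by (simp add: abs_mult mult_left_le_one_le)
    then show "- \<bar>v\<bar> \<le> y $ a * v" by linarith
  qed
  then have "bdd_below ((\<lambda>y. \<Sum>a\<in>A j. \<Sum>k\<in>C j a. y $ a * subtree_value f k x) ` X j)"
    by (intro bdd_below_sum)
  moreover have "bdd_below (f j ` X j)"
    using assms by (intro convex_on_bounded_below compact_imp_bounded X_compact)
  ultimately show ?thesis
    unfolding local_loss_def by (intro bdd_below_add) auto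
qed

section \<open>Existence of a maximizing comparator\<close>

lemma compact_strategies: "compact strategies"
proof -
  \<comment> \<open>Singleton factors outside \<open>J\<close> make this a product over the whole
    index type, where Tychonoff's theorem applies.\<close>
  have "strategies = Pi\<^sub>E UNIV (\<lambda>j. if j \<in> J then X j else {undefined})"
    unfolding strategies_def by (auto simp: PiE_iff extensional_def split: if_splits)
  moreover have "compactin (product_topology (\<lambda>_. euclidean) UNIV)
      (Pi\<^sub>E UNIV (\<lambda>j. if j \<in> J then X j else {undefined}))"
    using X_compact by (auto simp: compactin_PiE)
  ultimately show ?thesis by (simp add: euclidean_product_topology)
qed

lemma strategies_nonempty: "strategies \<noteq> {}"
  using X_nonempty by (auto simp: strategies_def PiE_eq_empty_iff)

lemma continuous_on_reach: "continuous_on S (reach j)"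
proof -
  have "continuous_on S (\<lambda>x. \<Prod>(i, a)\<leftarrow>p. x i $ a)" for p :: "('j \<times> 'a) list"
    by (induction p)
      (auto intro!: continuous_intros continuous_on_product_coordinates [THEN continuous_on_subset])
  then show ?thesis unfolding reach_def [abs_def] by simp
qed

text \<open>Only the reach factors vary with the comparator, and they are finite products of
  coordinates, hence continuous.\<close>

lemma weighted_regret_attains_max:
  obtains y where "y \<in> strategies"
    "\<And>z. z \<in> strategies \<Longrightarrow> weighted_regret l x T z \<le> weighted_regret l x T y"
proof -
  have "continuous_on strategies (weighted_regret l x T)"
    unfolding weighted_regret_def [abs_def] by (intro continuous_intros continuous_on_reach)
  then show ?thesis
    using continuous_attains_sup [OF compact_strategies strategies_nonempty] that by blast
qed

text \<open>In the decomposition of the regret against \<open>y\<close>, replacing each local loss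
  at \<open>y j\<close> by the infimum over \<open>X j\<close> can only increase the sum, as the
  weights are nonnegative.\<close>

lemma comparator_regret_le:
  assumes y: "y \<in> strategies"
    and convex: "\<And>t j. t \<in> {1..T} \<Longrightarrow> j \<in> J \<Longrightarrow> convex_on (X j) (l t j)"
  shows "(\<Sum>t=1..T. total_loss (l t) (x t)) - (\<Sum>t=1..T. total_loss (l t) y)
    \<le> weighted_regret l x T y"
proof -
  have "(\<Sum>t=1..T. total_loss (l t) (x t)) - (\<Sum>t=1..T. total_loss (l t) y)
    = (\<Sum>j\<in>J. reach j y * ((\<Sum>t=1..T. local_loss (l t) (x t) j (x t j))
        - (\<Sum>t=1..T. local_loss (l t) (x t) j (y j))))"
    by (simp add: sum_subtractf [symmetric] total_loss_diff sum_distrib_left)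
      (rule sum.swap)
  also have "\<dots> \<le> weighted_regret l x T y"
    unfolding weighted_regret_def laminar_regret_def
  proof (intro sum_mono mult_left_mono diff_left_mono cINF_lower)
    fix j assume j: "j \<in> J"
    show "bdd_below ((\<lambda>y. \<Sum>t=1..T. local_loss (l t) (x t) j y) ` X j)"
      using j convex by (intro bdd_below_sum bdd_below_local_loss)
    show "y j \<in> X j" using j y by (auto simp: strategies_def)
    show "0 \<le> reach j y" using y j by (rule reach_nonneg)
  qed
  finally show ?thesis .
qed

end

theorem theorem2:
  fixes J :: "'j set"
    and A :: "'j \<Rightarrow> 'a::finite set"
    and C :: "'j \<Rightarrow> 'a \<Rightarrow> 'j set"
    and r :: 'j
    and X :: "'j \<Rightarrow> (real ^ 'a) set"
    and T :: nat
    and x :: "nat \<Rightarrow> 'j \<Rightarrow> real ^ 'a"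
    and l :: "nat \<Rightarrow> 'j \<Rightarrow> real ^ 'a \<Rightarrow> real"
  assumes "decision_process J A C r X"
    and "T \<ge> 1"
    and "\<And>t. t \<in> {1..T} \<Longrightarrow> x t \<in> decision_process.strategies J X"
    and "\<And>t j. t \<in> {1..T} \<Longrightarrow> j \<in> J \<Longrightarrow> convex_on (X j) (l t j)"
  shows "\<exists>y \<in> decision_process.strategies J X.
    (\<forall>z \<in> decision_process.strategies J X.
      decision_process.weighted_regret J A C r X l x T z
        \<le> decision_process.weighted_regret J A C r X l x T y) \<and>
    decision_process.regret J A C r X l x T
      \<le> decision_process.weighted_regret J A C r X l x T y"
proof -
  interpret decision_process J A C r X by fact
  obtain y where y: "y \<in> strategies"
    and max: "\<And>z. z \<in> strategies \<Longrightarrow> weighted_regret l x T z \<le> weighted_regret l x T y"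
    using weighted_regret_attains_max by blast
  \<comment> \<open>Written as a lower bound uniform in \<open>z\<close>, the estimate passes to the
    infimum even if that is not attained.\<close>
  have "(\<Sum>t=1..T. total_loss (l t) (x t)) - weighted_regret l x T y
      \<le> (\<Sum>t=1..T. total_loss (l t) z)" if "z \<in> strategies" for z
    using comparator_regret_le [of z T l x] that assms(4) max [OF that] by simp
  then have "(\<Sum>t=1..T. total_loss (l t) (x t)) - weighted_regret l x T y
      \<le> (INF z\<in>strategies. \<Sum>t=1..T. total_loss (l t) z)"
    using strategies_nonempty by (intro cINF_greatest)
  then have "regret l x T \<le> weighted_regret l x T y" by (simp add: regret_def)
  with y max show ?thesis by blast
qed

end
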